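(* Let $K$ be a field complete with respect to a discrete non-archimedean valuation, with residue field $k$, and assume that $k$ is finite. Let $F=(f_1,\ldots,f_n)$ be a regular system of $n$ nonzero polynomials in $K[X_1^{\pm1},\ldots,X_n^{\pm1}]$, and let $t_i$ be the number of nonzero monomials of $f_i$. Then the number of zeros of $F$ in $(K^\ast)^n$ is at most $\binom{t_1}{2}\cdots\binom{t_n}{2}\,|k^\ast|^n$.
   Context: Let $v:K\to\mathbb{R}\cup\{\infty\}$ be the discrete (nontrivial) valuation, $A=\{x: v(x)\ge 0\}$ the valuation ring, $\mathfrak{M}=\{x:v(x)>0\}=\pi A$ its maximal ideal with a fixed generator $\pi$, and $k=A/\mathfrak{M}$. The first digit of $x\in K^\ast$ is $\delta(x)=\pi^{-v(x)/v(\pi)}x \bmod \mathfrak{M}\in k^\ast$. For a nonzero $f=\sum_{i=1}^t a_iX^{\alpha_i}\in K[X_1^{\pm1},\ldots,X_n^{\pm1}]$ (with $a_i\in K^\ast$ and distinct $\alpha_i\in\mathbb{Z}^n$) and $w\in\mathbb{R}^n$, put $l_i(f;w)=v(a_i)+\alpha_i\cdot w$ and $\mathrm{tr}(f;w)=\min_i l_i(f;w)$. The set $\mathrm{Trop}(f)\subseteq\mathbb{R}^n$ consists of the points where $\mathrm{tr}(f;\cdot)$ is not differentiable (equivalently, where the minimum is attained by at least two indices $i$). The lower polynomial is $f^{[w]}=\sum_{i:\,l_i(f;w)=\mathrm{tr}(f;w)}a_iX^{\alpha_i}$ and the initial form is $\mathrm{in}_w(f)=\sum_{i:\,l_i(f;w)=\mathrm{tr}(f;w)}\delta(a_i)X^{\alpha_i}\in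 k[X_1^{\pm1},\ldots,X_n^{\pm1}]$. For a system $F=(f_1,\ldots,f_n)$ of nonzero polynomials: $\mathrm{Trop}(F)=\bigcap_i\mathrm{Trop}(f_i)$, $F^{[w]}=(f_1^{[w]},\ldots,f_n^{[w]})$, $\mathrm{in}_w(F)=(\mathrm{in}_w(f_1),\ldots,\mathrm{in}_w(f_n))$. A zero of a square system is degenerate if the Jacobian determinant of the system vanishes at it. $F$ is semiregular at $w\in\mathbb{R}^n$ if either $w\notin\mathrm{Trop}(F)\cap v(\pi)\mathbb{Z}^n$ or $\mathrm{in}_w(F)$ has no degenerate zero in $(k^\ast)^n$. $F$ is regular if $\mathrm{Trop}(F)$ is finite and, for all $w\in\mathrm{Trop}(F)$, $F^{[w]}$ consists solely of binomials and $F$ is semiregular at $w$. *)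

theory Defs
  imports "HOL-Analysis.Analysis" "HOL-Library.Poly_Mapping"
begin

section \<open>Complete discretely valued fields\<close>

text \<open>The value group is required to be \<open>c\<int>\<close> with \<open>c > 0\<close>: a nontrivial discrete subgroup of the reals,
  not necessarily normalised to the integers.\<close>

locale discrete_valuation =
  fixes v :: "'a::field \<Rightarrow> ereal"
  assumes val_zero: "v 0 = \<infinity>"
    and val_mult: "v (x * y) = v x + v y"
    and val_add: "min (v x) (v y) \<le> v (x + y)"
    and value_group: "\<exists>c>0. v ` (- {0}) = range (\<lambda>m::int. ereal (c * of_int m))"

definition val_dist :: "('a::field \<Rightarrow> ereal) \<Rightarrow> 'a \<Rightarrow> 'a \<Rightarrow> real" where
  "val_dist v x y = (if x = y then 0 else exp (- real_of_ereal (v (x - y))))"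

lemma (in discrete_valuation) Metric_space_val_dist: "Metric_space UNIV (val_dist v)"
proof -
  obtain c where c: "c > 0" "v ` (- {0}) = range (\<lambda>m::int. ereal (c * of_int m))"
    using value_group by blast
  have fin: "\<exists>r. v x = ereal r" if "x \<noteq> 0" for x
    using c(2) that by (metis (no_types, lifting) Compl_iff image_iff imageI singletonD)
  obtain r where r: "v (1 :: 'a) = ereal r" using fin[of 1] by auto
  have "v (1 :: 'a) = v 1 + v 1" using val_mult[of 1 1] by simp
  then have one: "v 1 = 0" using r by simp
  obtain s where s: "v (- 1 :: 'a) = ereal s" using fin[of "- 1"] by auto
  have "v (1 :: 'a) = v (- 1) + v (- 1)" using val_mult[of "- 1" "- 1"] by simp
  then have minus_one: "v (- 1) = 0" using one s by simp
  have minus: "v (- x) = v x" for x using val_mult[of "- 1" x] minus_one by simp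
  show ?thesis
  proof
    fix x y z :: 'a
    show "0 \<le> val_dist v x y" by (simp add: val_dist_def)
    show "val_dist v x y = val_dist v y x"
      using minus[of "x - y"] by (simp add: val_dist_def)
    show "val_dist v x y = 0 \<longleftrightarrow> x = y" by (simp add: val_dist_def)
    show "val_dist v x z \<le> val_dist v x y + val_dist v y z"
    proof (cases "x = y \<or> y = z \<or> x = z")
      case True
      then show ?thesis by (auto simp: val_dist_def)
    next
      case False
      then obtain p q t where pqt: "v (x - y) = ereal p" "v (y - z) = ereal q" "v (x - z) = ereal t"
        using fin[of "x - y"] fin[of "y - z"] fin[of "x - z"] by auto
      have "min p q \<le> t" using val_add[of "x - y" "y - z"] pqt by (simp add: min_def split: if_splits)
      then have "exp (- t) \<le> exp (- p) \<or> exp (- t) \<le> exp (- q)" by auto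
      then have "exp (- t) \<le> exp (- p) + exp (- q)"
        using exp_ge_zero[of "- p"] exp_ge_zero[of "- q"] by linarith
      then show ?thesis using False pqt by (simp add: val_dist_def)
    qed
  qed
qed

definition val_complete :: "('a::field \<Rightarrow> ereal) \<Rightarrow> bool" where
  "val_complete v \<longleftrightarrow> Metric_space.mcomplete UNIV (val_dist v)"

definition val_ring :: "('a::field \<Rightarrow> ereal) \<Rightarrow> 'a set" where
  "val_ring v = {x. v x \<ge> 0}"

definition max_ideal :: "('a::field \<Rightarrow> ereal) \<Rightarrow> 'a set" where
  "max_ideal v = {x. v x > 0}"

definition uniformizer :: "('a::field \<Rightarrow> ereal) \<Rightarrow> 'a \<Rightarrow> bool" where
  "uniformizer v \<pi> \<longleftrightarrow> max_ideal v = (\<lambda>a. \<pi> * a) ` val_ring v"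

text \<open>The residue field is a type \<open>'k\<close> together with the reduction map: a surjective ring homomorphism
  from the valuation ring onto \<open>'k\<close> whose kernel is the maximal ideal.  The values of \<open>res\<close>
  outside the valuation ring are irrelevant.\<close>

locale residue_map =
  fixes v :: "'a::field \<Rightarrow> ereal" and res :: "'a \<Rightarrow> 'k::field"
  assumes res_one: "res 1 = 1"
    and res_add: "x \<in> val_ring v \<Longrightarrow> y \<in> val_ring v \<Longrightarrow> res (x + y) = res x + res y"
    and res_mult: "x \<in> val_ring v \<Longrightarrow> y \<in> val_ring v \<Longrightarrow> res (x * y) = res x * res y"
    and res_surj: "res ` val_ring v = UNIV"
    and res_kernel: "{x \<in> val_ring v. res x = 0} = max_ideal v"

text \<open>For \<open>x \<noteq> 0\<close> the quotient \<open>v x / v \<pi>\<close> is an integer; \<open>floor\<close> only changes its type.\<close>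

definition first_digit :: "('a::field \<Rightarrow> ereal) \<Rightarrow> 'a \<Rightarrow> ('a \<Rightarrow> 'k::field) \<Rightarrow> 'a \<Rightarrow> 'k" where
  "first_digit v \<pi> res x =
     res (\<pi> powi (- \<lfloor>real_of_ereal (v x) / real_of_ereal (v \<pi>)\<rfloor>) * x)"


section \<open>Laurent polynomials\<close>

text \<open>The type \<open>int ^ 'n \<Rightarrow>\<^sub>0 'a\<close> is the group algebra of the free abelian group of rank \<open>n\<close>, i.e. the ring of
  Laurent polynomials: \<open>Poly_Mapping.keys f\<close> is the set of exponent vectors and \<open>Poly_Mapping.lookup f \<alpha>\<close> the
  coefficient at \<open>\<alpha>\<close>.\<close>

type_synonym ('a, 'n) laurent = "(int ^ 'n) \<Rightarrow>\<^sub>0 'a"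

definition eval_laurent :: "('a::field, 'n::finite) laurent \<Rightarrow> 'a ^ 'n \<Rightarrow> 'a" where
  "eval_laurent f x = (\<Sum>\<alpha>\<in>Poly_Mapping.keys f. Poly_Mapping.lookup f \<alpha> * (\<Prod>i\<in>UNIV. (x $ i) powi (\<alpha> $ i)))"

definition partial_laurent :: "'n::finite \<Rightarrow> ('a::field, 'n) laurent \<Rightarrow> ('a, 'n) laurent" where
  "partial_laurent j f =
     (\<Sum>\<alpha>\<in>Poly_Mapping.keys f. Poly_Mapping.single (\<alpha> - axis j 1) (of_int (\<alpha> $ j) * Poly_Mapping.lookup f \<alpha>))"

definition jacobian_det :: "('n::finite \<Rightarrow> ('a::field, 'n) laurent) \<Rightarrow> 'a ^ 'n \<Rightarrow> 'a" where
  "jacobian_det F x = det (\<chi> i j. eval_laurent (partial_laurent j (F i)) x)"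

definition torus_zeros :: "('n::finite \<Rightarrow> ('a::field, 'n) laurent) \<Rightarrow> ('a ^ 'n) set" where
  "torus_zeros F = {x. (\<forall>i. x $ i \<noteq> 0) \<and> (\<forall>i. eval_laurent (F i) x = 0)}"

definition degenerate_zero :: "('n::finite \<Rightarrow> ('a::field, 'n) laurent) \<Rightarrow> 'a ^ 'n \<Rightarrow> bool" where
  "degenerate_zero F x \<longleftrightarrow> x \<in> torus_zeros F \<and> jacobian_det F x = 0"


section \<open>Tropical hypersurfaces and regular systems\<close>

definition real_vec :: "int ^ 'n \<Rightarrow> real ^ 'n" where
  "real_vec \<alpha> = (\<chi> i. of_int (\<alpha> $ i))"

definition trop_term ::
    "('a::field \<Rightarrow> ereal) \<Rightarrow> ('a, 'n::finite) laurent \<Rightarrow> int ^ 'n \<Rightarrow> real ^ 'n \<Rightarrow> real" where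
  "trop_term v f \<alpha> w = real_of_ereal (v (Poly_Mapping.lookup f \<alpha>)) + real_vec \<alpha> \<bullet> w"

definition tr :: "('a::field \<Rightarrow> ereal) \<Rightarrow> ('a, 'n::finite) laurent \<Rightarrow> real ^ 'n \<Rightarrow> real" where
  "tr v f w = Min ((\<lambda>\<alpha>. trop_term v f \<alpha> w) ` Poly_Mapping.keys f)"

definition Trop :: "('a::field \<Rightarrow> ereal) \<Rightarrow> ('a, 'n::finite) laurent \<Rightarrow> (real ^ 'n) set" where
  "Trop v f = {w. \<not> tr v f differentiable (at w)}"

definition min_keys ::
    "('a::field \<Rightarrow> ereal) \<Rightarrow> ('a, 'n::finite) laurent \<Rightarrow> real ^ 'n \<Rightarrow> (int ^ 'n) set" where
  "min_keys v f w = {\<alpha> \<in> Poly_Mapping.keys f. trop_term v f \<alpha> w = tr v f w}"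

definition lower_poly ::
    "('a::field \<Rightarrow> ereal) \<Rightarrow> ('a, 'n::finite) laurent \<Rightarrow> real ^ 'n \<Rightarrow> ('a, 'n) laurent" where
  "lower_poly v f w = (\<Sum>\<alpha>\<in>min_keys v f w. Poly_Mapping.single \<alpha> (Poly_Mapping.lookup f \<alpha>))"

definition initial_form ::
    "('a::field \<Rightarrow> ereal) \<Rightarrow> 'a \<Rightarrow> ('a \<Rightarrow> 'k::field) \<Rightarrow> ('a, 'n::finite) laurent \<Rightarrow> real ^ 'n
      \<Rightarrow> ('k, 'n) laurent" where
  "initial_form v \<pi> res f w =
     (\<Sum>\<alpha>\<in>min_keys v f w. Poly_Mapping.single \<alpha> (first_digit v \<pi> res (Poly_Mapping.lookup f \<alpha>)))"

definition Trop_sys ::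
    "('a::field \<Rightarrow> ereal) \<Rightarrow> ('n::finite \<Rightarrow> ('a, 'n) laurent) \<Rightarrow> (real ^ 'n) set" where
  "Trop_sys v F = (\<Inter>i. Trop v (F i))"

definition semiregular ::
    "('a::field \<Rightarrow> ereal) \<Rightarrow> 'a \<Rightarrow> ('a \<Rightarrow> 'k::field) \<Rightarrow> ('n::finite \<Rightarrow> ('a, 'n) laurent)
      \<Rightarrow> real ^ 'n \<Rightarrow> bool" where
  "semiregular v \<pi> res F w \<longleftrightarrow>
     w \<notin> Trop_sys v F \<inter> range (\<lambda>m. real_of_ereal (v \<pi>) *\<^sub>R real_vec m) \<or>
     \<not> (\<exists>x. degenerate_zero (\<lambda>i. initial_form v \<pi> res (F i) w) x)"

definition regular ::
    "('a::field \<Rightarrow> ereal) \<Rightarrow> 'a \<Rightarrow> ('a \<Rightarrow> 'k::field) \<Rightarrow> ('n::finite \<Rightarrow> ('a, 'n) laurent) \<Rightarrow> bool" where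
  "regular v \<pi> res F \<longleftrightarrow>
     finite (Trop_sys v F) \<and>
     (\<forall>w\<in>Trop_sys v F. (\<forall>i. card (Poly_Mapping.keys (lower_poly v (F i) w)) = 2) \<and> semiregular v \<pi> res F w)"

end

theory Submission
  imports Defs
begin

text \<open>The zeros are counted by sending a zero \<open>x\<close> to the pair formed by its vector of values \<open>v(x)\<close>
  and its vector of first digits.  Three facts give the bound.

  First, the terms of \<open>f\<close> at a zero \<open>x\<close> sum to \<open>0\<close>.  After division by the power of \<open>\<pi>\<close> that
  makes their least order \<open>0\<close>, reduction to the residue field keeps only the terms of least order
  and turns each of them into its first digit.  Hence the digit vector is a zero of the initial form
  at \<open>v(x)\<close> (\<open>initial_form_zero\<close>), and the initial form cannot be a monomial, so that the minimum
  defining \<open>tr\<close> is attained twice and \<open>v(x)\<close> lies in \<open>Trop v f\<close>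
  (\<open>zero_val_vec_in_Trop\<close>).

  Second, the pair \<open>(v(x), digits)\<close> determines \<open>x\<close>; this is the uniqueness half of Hensel's lemma.
  Two distinct zeros \<open>x\<close> and \<open>y\<close> with the same data satisfy \<open>y\<^sub>i = x\<^sub>i (1 + b g\<^sub>i)\<close>, where \<open>b\<close> has
  positive value, all \<open>g\<^sub>i\<close> are integral, and one of them is \<open>1\<close>.  To first order in \<open>b\<close> the
  difference of the two equations \<open>f(y) = f(x) = 0\<close> says that the residues of the \<open>g\<^sub>i\<close> form a
  nonzero kernel vector of the logarithmic Jacobian matrix of the initial forms, so that the digit
  vector is a degenerate zero (\<open>distinct_zeros_imp_degenerate\<close>), which semiregularity excludes.

  Third, a point of \<open>Trop_sys v F\<close> is determined by the pairs of exponents that are minimal there,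
  since otherwise \<open>Trop_sys v F\<close> would contain a segment (\<open>card_Trop_sys_le\<close>).  This leaves at most
  the product of the \<open>t\<^sub>i choose 2\<close> value vectors, each with at most \<open>|k\<^sup>*|\<^sup>n\<close> digit
  vectors.\<close>

section \<open>Tropical hypersurfaces\<close>

lemma mem_min_keys_iff:
  "\<alpha> \<in> min_keys v f w \<longleftrightarrow>
     \<alpha> \<in> Poly_Mapping.keys f \<and> (\<forall>\<beta>\<in>Poly_Mapping.keys f. trop_term v f \<alpha> w \<le> trop_term v f \<beta> w)"
proof
  assume "\<alpha> \<in> min_keys v f w"
  then show "\<alpha> \<in> Poly_Mapping.keys f \<and> (\<forall>\<beta>\<in>Poly_Mapping.keys f. trop_term v f \<alpha> w \<le> trop_term v f \<beta> w)"
    by (simp add: min_keys_def tr_def)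
next
  assume a: "\<alpha> \<in> Poly_Mapping.keys f \<and> (\<forall>\<beta>\<in>Poly_Mapping.keys f. trop_term v f \<alpha> w \<le> trop_term v f \<beta> w)"
  then have "tr v f w = trop_term v f \<alpha> w"
    unfolding tr_def by (intro Min_eqI) auto
  then show "\<alpha> \<in> min_keys v f w" using a by (simp add: min_keys_def)
qed

lemma min_keys_subset: "min_keys v f w \<subseteq> Poly_Mapping.keys f"
  by (auto simp: min_keys_def)

lemma finite_min_keys [simp]: "finite (min_keys v f w)"
  by (rule finite_subset[OF min_keys_subset]) simp

lemma min_keys_nonempty:
  assumes "f \<noteq> 0"
  shows "min_keys v f w \<noteq> {}"
proof -
  have "tr v f w \<in> (\<lambda>\<alpha>. trop_term v f \<alpha> w) ` Poly_Mapping.keys f"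
    unfolding tr_def using assms by (intro Min_in) auto
  then show ?thesis by (auto simp: min_keys_def)
qed

text \<open>No coefficient of a minimal term vanishes, so counting the monomials of the lower polynomial
  counts the minimising exponents.\<close>

lemma keys_lower_poly: "Poly_Mapping.keys (lower_poly v f w) = min_keys v f w"
proof -
  have "Poly_Mapping.lookup (lower_poly v f w) \<beta>
      = (if \<beta> \<in> min_keys v f w then Poly_Mapping.lookup f \<beta> else 0)" for \<beta>
    by (simp add: lower_poly_def lookup_sum lookup_single when_def)
  then show ?thesis
    using min_keys_subset[of v f w] by (auto simp: in_keys_iff split: if_splits)
qed

lemma inner_real_vec: "real_vec \<alpha> \<bullet> real_vec \<beta> = of_int (\<Sum>j\<in>UNIV. \<alpha> $ j * \<beta> $ j)"
  by (simp add: real_vec_def inner_vec_def)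

lemma real_vec_inject: "real_vec \<alpha> = real_vec \<beta> \<Longrightarrow> \<alpha> = \<beta>"
  by (simp add: real_vec_def vec_eq_iff)

text \<open>Where \<open>tr v f\<close> is differentiable it lies below each affine function \<open>trop_term v f \<alpha>\<close>
  and touches those with \<open>\<alpha>\<close> minimising, so its gradient is every such \<open>\<alpha>\<close>.\<close>

lemma two_min_keys_imp_Trop:
  assumes "\<alpha> \<in> min_keys v f w" "\<beta> \<in> min_keys v f w" "\<alpha> \<noteq> \<beta>"
  shows "w \<in> Trop v f"
proof (rule ccontr)
  assume "w \<notin> Trop v f"
  then obtain D where D: "(tr v f has_derivative D) (at w)"
    by (auto simp: Trop_def differentiable_def)
  have gradient: "(\<lambda>h. real_vec \<gamma> \<bullet> h) = D" if "\<gamma> \<in> min_keys v f w" for \<gamma>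
  proof -
    have der: "((\<lambda>u. trop_term v f \<gamma> u - tr v f u) has_derivative (\<lambda>h. real_vec \<gamma> \<bullet> h - D h)) (at w)"
      unfolding trop_term_def by (auto intro!: derivative_eq_intros D)
    have "tr v f u \<le> trop_term v f \<gamma> u" for u
      using that by (simp add: min_keys_def tr_def)
    then have "eventually (\<lambda>u. trop_term v f \<gamma> w - tr v f w \<le> trop_term v f \<gamma> u - tr v f u) (at w)"
      using that by (simp add: min_keys_def)
    from has_derivative_local_min[OF der this] show ?thesis by (auto simp: fun_eq_iff)
  qed
  have "(\<lambda>h. real_vec \<alpha> \<bullet> h) = (\<lambda>h. real_vec \<beta> \<bullet> h)"
    using gradient[OF assms(1)] gradient[OF assms(2)] by simp
  then have "real_vec \<alpha> = real_vec \<beta>"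
    using vector_eq_ldot[of "real_vec \<alpha>" "real_vec \<beta>"] by (metis inner_commute)
  then show False using real_vec_inject assms(3) by blast
qed

text \<open>The terms are affine in \<open>w\<close>, so an exponent that is minimal at both ends of a segment is
  minimal along it.\<close>

lemma min_keys_closed_segment:
  assumes "\<alpha> \<in> min_keys v f w" "\<alpha> \<in> min_keys v f w'" "u \<in> closed_segment w w'"
  shows "\<alpha> \<in> min_keys v f u"
proof -
  obtain t where t: "0 \<le> t" "t \<le> 1" "u = (1 - t) *\<^sub>R w + t *\<^sub>R w'"
    using assms(3) by (auto simp: in_segment)
  have affine: "trop_term v f \<beta> u = (1 - t) * trop_term v f \<beta> w + t * trop_term v f \<beta> w'" for \<beta>
    unfolding trop_term_def t(3) by (simp add: inner_add_right algebra_simps)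
  show ?thesis
    unfolding mem_min_keys_iff
  proof (intro conjI ballI)
    show "\<alpha> \<in> Poly_Mapping.keys f" using assms(1) by (simp add: mem_min_keys_iff)
    fix \<beta> assume "\<beta> \<in> Poly_Mapping.keys f"
    then show "trop_term v f \<alpha> u \<le> trop_term v f \<beta> u"
      unfolding affine using assms(1,2) t(1,2) by (intro add_mono mult_left_mono) (auto simp: mem_min_keys_iff)
  qed
qed

text \<open>A point of the tropical prevariety is determined by the pairs of exponents that are minimal
  there: two points with the same pairs would be joined by a segment lying inside the finite set
  \<open>Trop_sys v F\<close>.\<close>

lemma card_Trop_sys_le:
  fixes F :: "'n::finite \<Rightarrow> ('a::field, 'n) laurent"
  assumes fin: "finite (Trop_sys v F)"
    and two: "\<And>w i. w \<in> Trop_sys v F \<Longrightarrow> card (min_keys v (F i) w) = 2"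
  shows "card (Trop_sys v F) \<le> (\<Prod>i\<in>UNIV. card (Poly_Mapping.keys (F i)) choose 2)"
proof -
  define pairs where "pairs i = {S. S \<subseteq> Poly_Mapping.keys (F i) \<and> card S = 2}" for i
  have "inj_on (\<lambda>w i. min_keys v (F i) w) (Trop_sys v F)"
  proof (rule inj_onI)
    fix w w' assume w: "w \<in> Trop_sys v F" "w' \<in> Trop_sys v F"
      and eq: "(\<lambda>i. min_keys v (F i) w) = (\<lambda>i. min_keys v (F i) w')"
    have "u \<in> Trop v (F i)" if u: "u \<in> closed_segment w w'" for u i
    proof -
      obtain \<alpha> \<beta> where ab: "min_keys v (F i) w = {\<alpha>, \<beta>}" "\<alpha> \<noteq> \<beta>"
        using two[OF w(1), of i] unfolding card_2_iff by blast
      have "min_keys v (F i) w' = {\<alpha>, \<beta>}" using eq ab by (metis (full_types))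
      then have "\<alpha> \<in> min_keys v (F i) u" "\<beta> \<in> min_keys v (F i) u"
        by (intro min_keys_closed_segment[OF _ _ u]; simp add: ab)+
      then show ?thesis using ab(2) two_min_keys_imp_Trop by blast
    qed
    then have "closed_segment w w' \<subseteq> Trop_sys v F" by (auto simp: Trop_sys_def)
    then show "w = w'" using fin finite_subset finite_closed_segment by blast
  qed
  moreover have "(\<lambda>w i. min_keys v (F i) w) ` Trop_sys v F \<subseteq> (\<Pi>\<^sub>E i\<in>UNIV. pairs i)"
    using two min_keys_subset by (fastforce simp: pairs_def)
  moreover have "finite (\<Pi>\<^sub>E i\<in>UNIV. pairs i)"
    by (intro finite_PiE) (auto simp: pairs_def)
  ultimately have "card (Trop_sys v F) \<le> card (\<Pi>\<^sub>E i\<in>UNIV. pairs i)"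
    by (rule card_inj_on_le)
  also have "\<dots> = (\<Prod>i\<in>UNIV. card (Poly_Mapping.keys (F i)) choose 2)"
    by (simp add: card_PiE pairs_def n_subsets)
  finally show ?thesis .
qed

section \<open>Evaluation of Laurent polynomials\<close>

abbreviation eval_monomial :: "int ^ 'n \<Rightarrow> 'a::field ^ 'n::finite \<Rightarrow> 'a" where
  "eval_monomial \<alpha> x \<equiv> (\<Prod>i\<in>UNIV. (x $ i) powi (\<alpha> $ i))"

lemma eval_laurent_superset:
  assumes "finite S" "Poly_Mapping.keys f \<subseteq> S"
  shows "eval_laurent f x = (\<Sum>\<alpha>\<in>S. Poly_Mapping.lookup f \<alpha> * eval_monomial \<alpha> x)"
  unfolding eval_laurent_def
  using assms by (intro sum.mono_neutral_left) (auto simp: in_keys_iff)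

lemma eval_laurent_single: "eval_laurent (Poly_Mapping.single \<alpha> c) x = c * eval_monomial \<alpha> x"
  by (subst eval_laurent_superset[of "{\<alpha>}"]) auto

lemma eval_laurent_add: "eval_laurent (f + g) x = eval_laurent f x + eval_laurent g x"
proof -
  let ?S = "Poly_Mapping.keys f \<union> Poly_Mapping.keys g"
  have "finite ?S" "Poly_Mapping.keys (f + g) \<subseteq> ?S" using keys_add[of f g] by auto
  then show ?thesis
    using eval_laurent_superset[of ?S f x] eval_laurent_superset[of ?S g x]
      eval_laurent_superset[of ?S "f + g" x]
    by (simp add: lookup_add ring_distribs sum.distrib)
qed

lemma eval_laurent_sum: "eval_laurent (\<Sum>i\<in>I. f i) x = (\<Sum>i\<in>I. eval_laurent (f i) x)"
proof (induction I rule: infinite_finite_induct)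
  case (insert i I)
  then show ?case by (simp add: eval_laurent_add)
qed (simp_all add: eval_laurent_def)

text \<open>The logarithmic derivative \<open>x\<^sub>j \<partial>f/\<partial>x\<^sub>j\<close> multiplies each term by its exponent.\<close>

lemma eval_partial_laurent:
  assumes "\<And>i. x $ i \<noteq> 0"
  shows "x $ j * eval_laurent (partial_laurent j f) x
    = (\<Sum>\<alpha>\<in>Poly_Mapping.keys f. of_int (\<alpha> $ j) * (Poly_Mapping.lookup f \<alpha> * eval_monomial \<alpha> x))"
proof -
  have shift: "x $ j * eval_monomial (\<alpha> - axis j 1) x = eval_monomial \<alpha> x" for \<alpha>
  proof -
    have "eval_monomial (\<alpha> - axis j 1) x
        = x $ j powi (\<alpha> $ j - 1) * (\<Prod>i\<in>UNIV - {j}. x $ i powi ((\<alpha> - axis j 1) $ i))"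
      by (subst prod.remove[of UNIV j]) (auto simp: axis_def)
    also have "(\<Prod>i\<in>UNIV - {j}. x $ i powi ((\<alpha> - axis j 1) $ i)) = (\<Prod>i\<in>UNIV - {j}. x $ i powi (\<alpha> $ i))"
      by (intro prod.cong) (auto simp: axis_def)
    finally have "x $ j * eval_monomial (\<alpha> - axis j 1) x
        = x $ j powi (\<alpha> $ j) * (\<Prod>i\<in>UNIV - {j}. x $ i powi (\<alpha> $ i))"
      using assms[of j] by (simp add: power_int_diff)
    also have "\<dots> = eval_monomial \<alpha> x" by (subst prod.remove[of UNIV j]) auto
    finally show ?thesis .
  qed
  have "x $ j * eval_laurent (partial_laurent j f) x
      = (\<Sum>\<alpha>\<in>Poly_Mapping.keys f. of_int (\<alpha> $ j) * Poly_Mapping.lookup f \<alpha> * (x $ j * eval_monomial (\<alpha> - axis j 1) x))"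
    by (simp add: partial_laurent_def eval_laurent_sum eval_laurent_single sum_distrib_left mult_ac)
  then show ?thesis by (simp only: shift mult.assoc)
qed

text \<open>A nonzero kernel vector \<open>\<eta>\<close> of the logarithmic Jacobian matrix \<open>(x\<^sub>j \<partial>f\<^sub>i/\<partial>x\<^sub>j)\<close>
  gives the kernel vector \<open>(x\<^sub>j \<eta>\<^sub>j)\<close> of the Jacobian matrix.\<close>

lemma jacobian_det_eq_0:
  fixes G :: "'n::finite \<Rightarrow> ('k::field, 'n) laurent"
  assumes nz: "\<And>i. x $ i \<noteq> 0" and eta: "\<eta> j0 \<noteq> 0"
    and ker: "\<And>i. (\<Sum>\<alpha>\<in>Poly_Mapping.keys (G i).
        Poly_Mapping.lookup (G i) \<alpha> * eval_monomial \<alpha> x * (\<Sum>j\<in>UNIV. of_int (\<alpha> $ j) * \<eta> j)) = 0"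
  shows "jacobian_det G x = 0"
proof (rule ccontr)
  define J where "J = (\<chi> i j. eval_laurent (partial_laurent j (G i)) x)"
  define z where "z = (\<chi> j. x $ j * \<eta> j)"
  assume "jacobian_det G x \<noteq> 0"
  then have "det J \<noteq> 0" by (simp add: jacobian_det_def J_def)
  then have "invertible J" by (simp add: invertible_det_nz)
  then have inj: "J *v z = 0 \<longrightarrow> z = 0"
    using matrix_left_invertible_ker[of J] invertible_left_inverse by blast
  have "(J *v z) $ i = 0" for i
  proof -
    have "(J *v z) $ i = (\<Sum>j\<in>UNIV. (x $ j * eval_laurent (partial_laurent j (G i)) x) * \<eta> j)"
      by (simp add: matrix_vector_mult_def J_def z_def mult_ac)
    also have "\<dots> = (\<Sum>j\<in>UNIV. \<Sum>\<alpha>\<in>Poly_Mapping.keys (G i).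
        of_int (\<alpha> $ j) * (Poly_Mapping.lookup (G i) \<alpha> * eval_monomial \<alpha> x) * \<eta> j)"
      by (simp add: eval_partial_laurent nz sum_distrib_right)
    also have "\<dots> = (\<Sum>\<alpha>\<in>Poly_Mapping.keys (G i). \<Sum>j\<in>UNIV.
        of_int (\<alpha> $ j) * (Poly_Mapping.lookup (G i) \<alpha> * eval_monomial \<alpha> x) * \<eta> j)"
      by (rule sum.swap)
    also have "\<dots> = 0"
      using ker[of i] by (simp add: sum_distrib_left sum_distrib_right mult_ac)
    finally show ?thesis .
  qed
  then have "J *v z = 0" by (simp add: vec_eq_iff)
  then have "x $ j0 * \<eta> j0 = 0" using inj by (simp add: z_def vec_eq_iff)
  then show False using nz eta by simp
qed

section \<open>Orders and first digits\<close>

locale valued_field_with_residue =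
  discrete_valuation v + residue_map v res
  for v :: "'a::field \<Rightarrow> ereal" and res :: "'a \<Rightarrow> 'k::field" +
  fixes \<pi> :: 'a
  assumes uniformizer: "uniformizer v \<pi>"
begin

definition val_gen :: real where
  "val_gen = real_of_ereal (v \<pi>)"

definition val_order :: "'a \<Rightarrow> int" where
  "val_order x = \<lfloor>real_of_ereal (v x) / real_of_ereal (v \<pi>)\<rfloor>"

abbreviation digit :: "'a \<Rightarrow> 'k" where
  "digit \<equiv> first_digit v \<pi> res"

text \<open>The uniformizer has the least positive value: it divides an element whose value generates
  the value group.\<close>

lemma uniformizer_pos_generates:
  shows "0 < val_gen"
    and "x \<noteq> 0 \<Longrightarrow> v x = ereal (val_gen * of_int (val_order x))"
proof -
  obtain c where c: "c > 0" "v ` (- {0}) = range (\<lambda>m::int. ereal (c * of_int m))"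
    using value_group by blast
  have fin: "\<exists>m::int. v x = ereal (c * of_int m)" if "x \<noteq> 0" for x
    using c(2) that by (metis (no_types, lifting) Compl_iff image_iff imageI singletonD)
  obtain p where p: "p \<noteq> 0" "v p = ereal c"
  proof -
    have "ereal (c * of_int 1) \<in> v ` (- {0})" unfolding c(2) by blast
    then obtain q where "q \<noteq> 0" "v q = ereal (c * of_int 1)" by (metis ComplD imageE singletonI)
    then show ?thesis using that by simp
  qed
  have "p \<in> max_ideal v" using p c by (simp add: max_ideal_def)
  then obtain a where a: "a \<in> val_ring v" "p = \<pi> * a"
    using uniformizer by (auto simp: uniformizer_def)
  have "1 \<in> val_ring v"
  proof -
    obtain m where "v 1 = ereal (c * of_int m)" using fin[of 1] by auto
    moreover have "v 1 = v 1 + v 1" using val_mult[of 1 1] by simp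
    ultimately show ?thesis by (auto simp: val_ring_def)
  qed
  then have "\<pi> * 1 \<in> max_ideal v" using uniformizer by (auto simp: uniformizer_def)
  then have pos: "v \<pi> > 0" by (simp add: max_ideal_def)
  have "\<pi> \<noteq> 0" "a \<noteq> 0" using a p by auto
  then obtain m n where m: "v \<pi> = ereal (c * of_int m)" and n: "v a = ereal (c * of_int n)"
    using fin by blast
  have "m > 0" using pos m c by (simp add: zero_less_mult_iff)
  moreover have "n \<ge> 0" using a(1) n c by (simp add: val_ring_def zero_le_mult_iff)
  moreover have "m + n = 1"
  proof -
    have "v p = ereal (c * of_int m + c * of_int n)" using a(2) m n val_mult by simp
    then have "c * of_int (m + n) = c * 1" using p(2) by (simp add: distrib_left)
    then show ?thesis using c(1) by (simp del: of_int_add)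
  qed
  ultimately have "m = 1" by linarith
  then have v_pi: "v \<pi> = ereal c" using m by simp
  then show "0 < val_gen" using c by (simp add: val_gen_def)
  show "v x = ereal (val_gen * of_int (val_order x))" if "x \<noteq> 0"
    using fin[OF that] v_pi c(1) by (auto simp: val_order_def val_gen_def)
qed

lemma pi_nonzero [simp]: "\<pi> \<noteq> 0"
  using uniformizer_pos_generates(1) val_zero by (auto simp: val_gen_def)

lemma val_order_eqI:
  assumes "v x = ereal (val_gen * of_int m)"
  shows "val_order x = m"
  using assms uniformizer_pos_generates(1) by (simp add: val_order_def flip: val_gen_def)

lemma val_order_mult: "x \<noteq> 0 \<Longrightarrow> y \<noteq> 0 \<Longrightarrow> val_order (x * y) = val_order x + val_order y"
  by (rule val_order_eqI) (simp add: val_mult uniformizer_pos_generates(2) distrib_left)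

lemma val_order_one [simp]: "val_order 1 = 0"
  using val_order_mult[of 1 1] by simp

lemma val_order_inverse: "x \<noteq> 0 \<Longrightarrow> val_order (inverse x) = - val_order x"
  using val_order_mult[of x "inverse x"] by simp

lemma val_order_power: "x \<noteq> 0 \<Longrightarrow> val_order (x ^ n) = int n * val_order x"
  by (induction n) (simp_all add: val_order_mult algebra_simps)

lemma val_order_power_int: "x \<noteq> 0 \<Longrightarrow> val_order (x powi n) = n * val_order x"
  by (simp add: power_int_def val_order_power val_order_inverse)

lemma val_order_prod:
  "(\<And>i. i \<in> I \<Longrightarrow> f i \<noteq> 0) \<Longrightarrow> val_order (\<Prod>i\<in>I. f i) = (\<Sum>i\<in>I. val_order (f i))"
  by (induction I rule: infinite_finite_induct) (simp_all add: val_order_mult)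

lemma val_order_pi [simp]: "val_order \<pi> = 1"
  using uniformizer_pos_generates(1) by (simp add: val_order_def flip: val_gen_def)

lemma val_ring_iff: "x \<noteq> 0 \<Longrightarrow> x \<in> val_ring v \<longleftrightarrow> val_order x \<ge> 0"
  using uniformizer_pos_generates by (simp add: val_ring_def zero_le_mult_iff)

lemma max_ideal_iff: "x \<noteq> 0 \<Longrightarrow> x \<in> max_ideal v \<longleftrightarrow> val_order x > 0"
  using uniformizer_pos_generates by (simp add: max_ideal_def zero_less_mult_iff)

lemma val_ring_zero [simp]: "0 \<in> val_ring v"
  by (simp add: val_ring_def val_zero)

lemma val_ring_one [simp]: "1 \<in> val_ring v"
  by (simp add: val_ring_iff)

lemma val_ring_add: "x \<in> val_ring v \<Longrightarrow> y \<in> val_ring v \<Longrightarrow> x + y \<in> val_ring v"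
  using val_add[of x y] by (auto simp: val_ring_def min_def split: if_splits)

lemma val_ring_mult: "x \<in> val_ring v \<Longrightarrow> y \<in> val_ring v \<Longrightarrow> x * y \<in> val_ring v"
  by (simp add: val_ring_def val_mult)

lemma val_ring_uminus: "x \<in> val_ring v \<Longrightarrow> - x \<in> val_ring v"
proof -
  have "val_order (- 1) + val_order (- 1) = 0"
    using val_order_mult[of "- 1" "- 1"] by simp
  then have "- 1 \<in> val_ring v" by (simp add: val_ring_iff)
  then show "x \<in> val_ring v \<Longrightarrow> - x \<in> val_ring v" using val_ring_mult[of "- 1" x] by simp
qed

lemma max_ideal_subset: "max_ideal v \<subseteq> val_ring v"
  by (auto simp: max_ideal_def val_ring_def)

lemma val_ring_sum: "(\<And>i. i \<in> I \<Longrightarrow> f i \<in> val_ring v) \<Longrightarrow> (\<Sum>i\<in>I. f i) \<in> val_ring v"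
  by (induction I rule: infinite_finite_induct) (auto intro: val_ring_add)

lemma res_eq_0_iff: "x \<in> val_ring v \<Longrightarrow> res x = 0 \<longleftrightarrow> x \<in> max_ideal v"
  using res_kernel by blast

lemma res_zero [simp]: "res 0 = 0"
  using res_eq_0_iff[of 0] by (simp add: max_ideal_def val_zero)

lemma res_uminus: "x \<in> val_ring v \<Longrightarrow> res (- x) = - res x"
  using res_add[of x "- x"] val_ring_uminus[of x] by (simp add: eq_neg_iff_add_eq_0 add.commute)

lemma res_sum:
  "(\<And>i. i \<in> I \<Longrightarrow> f i \<in> val_ring v) \<Longrightarrow> res (\<Sum>i\<in>I. f i) = (\<Sum>i\<in>I. res (f i))"
  by (induction I rule: infinite_finite_induct) (simp_all add: res_add val_ring_sum)

lemma val_order_scaled: "x \<noteq> 0 \<Longrightarrow> val_order (\<pi> powi n * x) = n + val_order x"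
  by (simp add: val_order_mult val_order_power_int)

lemma digit_nonzero: "x \<noteq> 0 \<Longrightarrow> digit x \<noteq> 0"
  using res_eq_0_iff[of "\<pi> powi (- val_order x) * x"]
  by (simp add: first_digit_def val_order_def[symmetric] val_ring_iff max_ideal_iff val_order_scaled)

text \<open>Scaling by \<open>\<pi> powi - N\<close> keeps exactly the terms of order \<open>N\<close> visible modulo the maximal
  ideal.\<close>

lemma scaled_in_val_ring: "x \<noteq> 0 \<Longrightarrow> N \<le> val_order x \<Longrightarrow> \<pi> powi (- N) * x \<in> val_ring v"
  by (simp add: val_ring_iff val_order_scaled)

lemma res_scaled:
  assumes "x \<noteq> 0" "N \<le> val_order x"
  shows "res (\<pi> powi (- N) * x) = (if val_order x = N then digit x else 0)"
proof (cases "val_order x = N")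
  case True
  then show ?thesis by (simp add: first_digit_def val_order_def)
next
  case False
  then have "\<pi> powi (- N) * x \<in> max_ideal v" using assms by (simp add: max_ideal_iff val_order_scaled)
  then show ?thesis using False res_eq_0_iff max_ideal_subset by auto
qed

lemma digit_mult:
  assumes "x \<noteq> 0" "y \<noteq> 0"
  shows "digit (x * y) = digit x * digit y"
proof -
  have split: "\<pi> powi (- val_order (x * y)) * (x * y) = (\<pi> powi (- val_order x) * x) * (\<pi> powi (- val_order y) * y)"
    using assms by (simp add: val_order_mult power_int_diff power_int_minus field_simps power_int_add)
  show ?thesis
    unfolding first_digit_def val_order_def[symmetric] split
    using assms by (intro res_mult scaled_in_val_ring) auto
qed

lemma digit_one [simp]: "digit 1 = 1"
  by (simp add: first_digit_def val_order_def[symmetric] res_one)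

lemma digit_inverse: "x \<noteq> 0 \<Longrightarrow> digit (inverse x) = inverse (digit x)"
  using digit_mult[of x "inverse x"] by (simp add: inverse_unique)

lemma digit_power: "x \<noteq> 0 \<Longrightarrow> digit (x ^ n) = digit x ^ n"
  by (induction n) (simp_all add: digit_mult)

lemma digit_power_int: "x \<noteq> 0 \<Longrightarrow> digit (x powi n) = digit x powi n"
  by (simp add: power_int_def digit_power digit_inverse)

lemma digit_prod: "(\<And>i. i \<in> I \<Longrightarrow> f i \<noteq> 0) \<Longrightarrow> digit (\<Prod>i\<in>I. f i) = (\<Prod>i\<in>I. digit (f i))"
  by (induction I rule: infinite_finite_induct) (simp_all add: digit_mult)

text \<open>The order and the first digit are multiplicative, so the quotient is a unit with residue \<open>1\<close>.\<close>

lemma ratio_minus_one_in_max_ideal: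
  assumes "x \<noteq> 0" "y \<noteq> 0" "val_order x = val_order y" "digit x = digit y"
  shows "y / x - 1 \<in> max_ideal v"
proof -
  have ord: "val_order (y / x) = 0"
    using assms by (simp add: divide_inverse val_order_mult val_order_inverse)
  have "digit (y / x) = 1"
    using assms digit_nonzero[of x] by (simp add: divide_inverse digit_mult digit_inverse)
  then have "res (y / x) = 1" using ord by (simp add: first_digit_def val_order_def[symmetric])
  moreover have ring: "y / x \<in> val_ring v" using assms ord by (simp add: val_ring_iff)
  moreover have m1: "- 1 \<in> val_ring v" using val_ring_uminus by simp
  ultimately have "res (y / x + (- 1)) = 0" using res_add[OF ring m1] res_uminus[of 1] by (simp add: res_one)
  then show ?thesis using res_eq_0_iff[OF val_ring_add[OF ring m1]] by simp
qed

section \<open>Linearisation of monomials\<close>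

text \<open>For \<open>b\<close> in the maximal ideal this says \<open>z \<equiv> 1 + b d\<close> modulo \<open>b\<close> times the maximal ideal, where \<open>d\<close> is a
  residue class.\<close>

definition linearizes :: "'a \<Rightarrow> 'a \<Rightarrow> 'k \<Rightarrow> bool" where
  "linearizes b z d \<longleftrightarrow> (\<exists>e\<in>val_ring v. z = 1 + b * e \<and> res e = d)"

lemma linearizes_one: "linearizes b 1 0"
  unfolding linearizes_def by (rule bexI[of _ 0]) auto

context
  fixes b :: 'a
  assumes b: "b \<in> max_ideal v"
begin

text \<open>First-order increments add under multiplication, the cross term \<open>b\<^sup>2 e e'\<close> being
  negligible because \<open>b\<close> lies in the maximal ideal.\<close>

lemma linearizes_mult:
  assumes "linearizes b z d" "linearizes b z' d'"
  shows "linearizes b (z * z') (d + d')"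
proof -
  obtain e e' where e: "e \<in> val_ring v" "z = 1 + b * e" "res e = d"
    and e': "e' \<in> val_ring v" "z' = 1 + b * e'" "res e' = d'"
    using assms unfolding linearizes_def by blast
  have bA: "b \<in> val_ring v" "res b = 0" using b max_ideal_subset res_eq_0_iff by auto
  have "e + e' + b * (e * e') \<in> val_ring v" "res (e + e' + b * (e * e')) = d + d'"
    using e e' bA by (simp_all add: val_ring_add val_ring_mult res_add res_mult)
  then show ?thesis
    unfolding linearizes_def using e(2) e'(2) by (intro bexI[of _ "e + e' + b * (e * e')"]) (simp_all add: algebra_simps)
qed

lemma linearizes_inverse:
  assumes "linearizes b z d"
  shows "linearizes b (inverse z) (- d)"
proof -
  obtain e where e: "e \<in> val_ring v" "z = 1 + b * e" "res e = d"
    using assms unfolding linearizes_def by blast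
  have bA: "b \<in> val_ring v" "res b = 0" using b max_ideal_subset res_eq_0_iff by auto
  have zA: "z \<in> val_ring v" and rz: "res z = 1"
    using e bA by (simp_all add: val_ring_add val_ring_mult res_add res_mult res_one)
  have z0: "z \<noteq> 0" using rz by auto
  have "\<not> val_order z > 0" using rz res_eq_0_iff[OF zA] max_ideal_iff[OF z0] by simp
  then have iA: "inverse z \<in> val_ring v" using z0 by (simp add: val_ring_iff val_order_inverse)
  have ri: "res (inverse z) = 1"
    using res_mult[OF zA iA] z0 rz by (simp add: res_one)
  have "- (e * inverse z) \<in> val_ring v" "res (- (e * inverse z)) = - d"
    using e iA ri by (simp_all add: val_ring_mult val_ring_uminus res_uminus res_mult)
  moreover have "inverse z = 1 + b * - (e * inverse z)"
    using e(2) z0 by (simp add: field_simps)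
  ultimately show ?thesis unfolding linearizes_def by blast
qed

lemma linearizes_power: "linearizes b z d \<Longrightarrow> linearizes b (z ^ n) (of_nat n * d)"
  by (induction n) (auto simp: linearizes_one distrib_right intro: linearizes_mult)

lemma linearizes_power_int:
  assumes "linearizes b z d"
  shows "linearizes b (z powi n) (of_int n * d)"
proof (cases "n \<ge> 0")
  case True
  then show ?thesis using linearizes_power[OF assms, of "nat n"] by (simp add: power_int_def)
next
  case False
  then show ?thesis using linearizes_power[OF linearizes_inverse[OF assms], of "nat (- n)"]
    by (simp add: power_int_def)
qed

lemma linearizes_prod:
  "(\<And>i. i \<in> I \<Longrightarrow> linearizes b (z i) (d i)) \<Longrightarrow> linearizes b (\<Prod>i\<in>I. z i) (\<Sum>i\<in>I. d i)"
  by (induction I rule: infinite_finite_induct) (simp_all add: linearizes_one linearizes_mult)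

end

section \<open>Zeros and initial forms\<close>

definition val_vec :: "'a ^ 'n \<Rightarrow> real ^ 'n" where
  "val_vec x = (\<chi> i. real_of_ereal (v (x $ i)))"

definition digit_vec :: "'a ^ 'n \<Rightarrow> 'k ^ 'n" where
  "digit_vec x = (\<chi> i. digit (x $ i))"

abbreviation term_at :: "('a, 'n::finite) laurent \<Rightarrow> 'a ^ 'n \<Rightarrow> int ^ 'n \<Rightarrow> 'a" where
  "term_at f x \<alpha> \<equiv> Poly_Mapping.lookup f \<alpha> * eval_monomial \<alpha> x"

text \<open>For \<open>x\<close> in the torus, in units of \<open>val_gen\<close>, this is \<open>tr v f\<close> at the value vector of \<open>x\<close>, but as an integer, so that
  it can serve as an exponent of \<open>\<pi>\<close>.\<close>

definition min_order :: "('a, 'n::finite) laurent \<Rightarrow> 'a ^ 'n \<Rightarrow> int" where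
  "min_order f x = Min ((\<lambda>\<alpha>. val_order (term_at f x \<alpha>)) ` Poly_Mapping.keys f)"

lemma val_vec_eq:
  assumes "\<And>i. x $ i \<noteq> 0"
  shows "val_vec x = val_gen *\<^sub>R real_vec (\<chi> i. val_order (x $ i))"
  using assms uniformizer_pos_generates(2) by (simp add: vec_eq_iff val_vec_def real_vec_def)

lemma term_at_nonzero:
  assumes "\<And>i. x $ i \<noteq> 0" "\<alpha> \<in> Poly_Mapping.keys f"
  shows "term_at f x \<alpha> \<noteq> 0"
  using assms by (simp add: in_keys_iff)

lemma digit_term_at:
  assumes "\<And>i. x $ i \<noteq> 0" "\<alpha> \<in> Poly_Mapping.keys f"
  shows "digit (term_at f x \<alpha>) = digit (Poly_Mapping.lookup f \<alpha>) * eval_monomial \<alpha> (digit_vec x)"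
  using assms by (simp add: in_keys_iff digit_mult digit_prod digit_power_int digit_vec_def)

lemma trop_term_val_vec:
  assumes "\<And>i. x $ i \<noteq> 0" "\<alpha> \<in> Poly_Mapping.keys f"
  shows "trop_term v f \<alpha> (val_vec x) = val_gen * of_int (val_order (term_at f x \<alpha>))"
  using assms uniformizer_pos_generates(2)[of "Poly_Mapping.lookup f \<alpha>"]
  by (simp add: trop_term_def val_vec_eq inner_real_vec in_keys_iff val_order_mult val_order_prod
      val_order_power_int distrib_left)

lemma min_order_le:
  "\<alpha> \<in> Poly_Mapping.keys f \<Longrightarrow> min_order f x \<le> val_order (term_at f x \<alpha>)"
  by (simp add: min_order_def)

lemma min_keys_val_vec:
  assumes "\<And>i. x $ i \<noteq> 0"
  shows "min_keys v f (val_vec x) = {\<alpha> \<in> Poly_Mapping.keys f. val_order (term_at f x \<alpha>) = min_order f x}"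
proof (intro set_eqI iffI)
  fix \<alpha> assume a: "\<alpha> \<in> min_keys v f (val_vec x)"
  then have "\<alpha> \<in> Poly_Mapping.keys f" by (simp add: mem_min_keys_iff)
  moreover have "val_order (term_at f x \<alpha>) \<le> val_order (term_at f x \<beta>)" if "\<beta> \<in> Poly_Mapping.keys f" for \<beta>
  proof -
    have "trop_term v f \<alpha> (val_vec x) \<le> trop_term v f \<beta> (val_vec x)" "\<alpha> \<in> Poly_Mapping.keys f"
      using a that by (auto simp: mem_min_keys_iff)
    then show ?thesis
      using that assms uniformizer_pos_generates(1) by (simp add: trop_term_val_vec)
  qed
  ultimately show "\<alpha> \<in> {\<alpha> \<in> Poly_Mapping.keys f. val_order (term_at f x \<alpha>) = min_order f x}"
    unfolding min_order_def by (auto intro!: Min_eqI[symmetric])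
next
  fix \<alpha> assume "\<alpha> \<in> {\<alpha> \<in> Poly_Mapping.keys f. val_order (term_at f x \<alpha>) = min_order f x}"
  then show "\<alpha> \<in> min_keys v f (val_vec x)"
    using assms uniformizer_pos_generates(1) min_order_le[of _ f x]
    by (auto simp: mem_min_keys_iff trop_term_val_vec)
qed

lemma scaled_term_in_val_ring:
  assumes "\<And>i. x $ i \<noteq> 0" "\<alpha> \<in> Poly_Mapping.keys f"
  shows "\<pi> powi (- min_order f x) * term_at f x \<alpha> \<in> val_ring v"
  using scaled_in_val_ring[OF term_at_nonzero[of x, OF assms] min_order_le[OF assms(2)]] .

lemma res_scaled_term:
  assumes "\<And>i. x $ i \<noteq> 0" "\<alpha> \<in> Poly_Mapping.keys f"
  shows "res (\<pi> powi (- min_order f x) * term_at f x \<alpha>)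
    = (if \<alpha> \<in> min_keys v f (val_vec x) then digit (term_at f x \<alpha>) else 0)"
  using res_scaled[OF term_at_nonzero[of x, OF assms] min_order_le[OF assms(2)]] assms
  by (simp add: min_keys_val_vec)

lemma lookup_initial_form:
  "Poly_Mapping.lookup (initial_form v \<pi> res f w) \<alpha>
    = (if \<alpha> \<in> min_keys v f w then digit (Poly_Mapping.lookup f \<alpha>) else 0)"
  by (simp add: initial_form_def lookup_sum lookup_single when_def)

lemma keys_initial_form: "Poly_Mapping.keys (initial_form v \<pi> res f w) = min_keys v f w"
  using min_keys_subset[of v f w] by (auto simp: in_keys_iff lookup_initial_form digit_nonzero split: if_splits)

lemma initial_form_term:
  assumes "\<And>i. x $ i \<noteq> 0" "\<alpha> \<in> min_keys v f (val_vec x)"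
  shows "Poly_Mapping.lookup (initial_form v \<pi> res f (val_vec x)) \<alpha> * eval_monomial \<alpha> (digit_vec x)
    = digit (term_at f x \<alpha>)"
  using assms digit_term_at[of x \<alpha> f] min_keys_subset[of v f "val_vec x"]
  by (auto simp: lookup_initial_form)

text \<open>Dividing a vanishing sum by \<open>\<pi> powi min_order f x\<close> and reducing it leaves only the terms of
  least order.  Constant weights \<open>1\<close> give the equation \<open>in\<^sub>w(f) = 0\<close>; the first-order increments of the
  monomials give its linearisation.\<close>

lemma weighted_residue_sum:
  assumes nz: "\<And>i. x $ i \<noteq> 0" and g: "\<And>\<alpha>. g \<alpha> \<in> val_ring v"
    and zero: "(\<Sum>\<alpha>\<in>Poly_Mapping.keys f. term_at f x \<alpha> * g \<alpha>) = 0"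
  shows "(\<Sum>\<alpha>\<in>min_keys v f (val_vec x). digit (term_at f x \<alpha>) * res (g \<alpha>)) = 0"
proof -
  let ?s = "\<lambda>\<alpha>. \<pi> powi (- min_order f x) * term_at f x \<alpha>"
  have s: "?s \<alpha> \<in> val_ring v" if "\<alpha> \<in> Poly_Mapping.keys f" for \<alpha>
    using scaled_term_in_val_ring[of x, OF nz that] .
  have "(\<Sum>\<alpha>\<in>Poly_Mapping.keys f. ?s \<alpha> * g \<alpha>) = 0"
    using zero by (simp add: mult.assoc sum_distrib_left[symmetric])
  then have "res (\<Sum>\<alpha>\<in>Poly_Mapping.keys f. ?s \<alpha> * g \<alpha>) = 0" by (simp only: res_zero)
  then have "(\<Sum>\<alpha>\<in>Poly_Mapping.keys f. res (?s \<alpha>) * res (g \<alpha>)) = 0"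
    using s g by (subst (asm) res_sum) (auto simp: val_ring_mult res_mult cong: sum.cong)
  also have "(\<Sum>\<alpha>\<in>Poly_Mapping.keys f. res (?s \<alpha>) * res (g \<alpha>))
      = (\<Sum>\<alpha>\<in>Poly_Mapping.keys f. (if \<alpha> \<in> min_keys v f (val_vec x) then digit (term_at f x \<alpha>) else 0) * res (g \<alpha>))"
    using res_scaled_term[of x, OF nz] by (intro sum.cong) auto
  also have "\<dots> = (\<Sum>\<alpha>\<in>min_keys v f (val_vec x). digit (term_at f x \<alpha>) * res (g \<alpha>))"
    using min_keys_subset[of v f "val_vec x"] by (intro sum.mono_neutral_cong_right) auto
  finally show ?thesis .
qed

lemma initial_form_zero:
  assumes nz: "\<And>i. x $ i \<noteq> 0" and zero: "eval_laurent f x = 0"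
  shows "eval_laurent (initial_form v \<pi> res f (val_vec x)) (digit_vec x) = 0"
proof -
  have "(\<Sum>\<alpha>\<in>min_keys v f (val_vec x). digit (term_at f x \<alpha>) * res 1) = 0"
    using zero by (intro weighted_residue_sum[of x "\<lambda>_. 1", OF nz]) (simp_all add: eval_laurent_def)
  then show ?thesis
    using initial_form_term[of x, OF nz]
    by (simp add: res_one eval_laurent_def keys_initial_form cong: sum.cong)
qed

text \<open>With a single minimal term the initial form would be a monomial, which has no zero in the
  torus.\<close>

lemma zero_val_vec_in_Trop:
  assumes nz: "\<And>i. x $ i \<noteq> 0" and zero: "eval_laurent f x = 0" and "f \<noteq> 0"
  shows "val_vec x \<in> Trop v f"
proof -
  obtain \<alpha> where a: "\<alpha> \<in> min_keys v f (val_vec x)" using min_keys_nonempty[OF \<open>f \<noteq> 0\<close>] by blast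
  have "min_keys v f (val_vec x) \<noteq> {\<alpha>}"
  proof
    assume single: "min_keys v f (val_vec x) = {\<alpha>}"
    have "digit (term_at f x \<alpha>) = 0"
      using initial_form_zero[of x f, OF nz zero] initial_form_term[of x, OF nz a] single
      by (simp add: eval_laurent_def keys_initial_form)
    moreover have "\<alpha> \<in> Poly_Mapping.keys f" using a min_keys_subset by blast
    ultimately show False using digit_nonzero term_at_nonzero[of x, OF nz] by blast
  qed
  then obtain \<beta> where "\<beta> \<in> min_keys v f (val_vec x)" "\<beta> \<noteq> \<alpha>" using a by blast
  then show ?thesis using a two_min_keys_imp_Trop by blast
qed

lemma digit_vec_torus_zero:
  assumes "x \<in> torus_zeros F"
  shows "digit_vec x \<in> torus_zeros (\<lambda>i. initial_form v \<pi> res (F i) (val_vec x))"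
  using assms initial_form_zero[of x] by (auto simp: torus_zeros_def digit_vec_def digit_nonzero)

text \<open>Writing \<open>y\<^sub>i = x\<^sub>i (1 + b g\<^sub>i)\<close> with \<open>b\<close> the largest of the relative differences, the equation
  \<open>f(y) - f(x) = 0\<close> divided by \<open>b\<close> reduces to the linear equation \<open>\<Sum>\<^sub>j x\<^sub>j \<partial>in\<^sub>w(f)/\<partial>x\<^sub>j \<cdot> g\<^sub>j = 0\<close>
  at the digit vector, and the residues of the \<open>g\<^sub>j\<close> do not all vanish.\<close>

lemma distinct_zeros_imp_degenerate:
  fixes F :: "'n::finite \<Rightarrow> ('a, 'n) laurent"
  assumes x: "x \<in> torus_zeros F" and y: "y \<in> torus_zeros F"
    and val: "val_vec x = val_vec y" and dig: "digit_vec x = digit_vec y" and "x \<noteq> y"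
  shows "degenerate_zero (\<lambda>i. initial_form v \<pi> res (F i) (val_vec x)) (digit_vec x)"
proof -
  have nzx: "x $ i \<noteq> 0" and nzy: "y $ i \<noteq> 0" for i using x y by (auto simp: torus_zeros_def)
  define h where "h i = y $ i / x $ i - 1" for i
  have ord: "val_order (x $ i) = val_order (y $ i)" for i
    using val by (simp add: val_vec_def vec_eq_iff val_order_def)
  have h: "h i \<in> max_ideal v" for i
    unfolding h_def using ratio_minus_one_in_max_ideal[OF nzx nzy ord] dig
    by (simp add: digit_vec_def vec_eq_iff)
  obtain i0 where "x $ i0 \<noteq> y $ i0"
    using \<open>x \<noteq> y\<close> by (auto simp: vec_eq_iff)
  then have "h i0 \<noteq> 0" using nzx by (simp add: h_def)
  define D where "D = {i. h i \<noteq> 0}"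
  have D: "finite D" "D \<noteq> {}" using \<open>h i0 \<noteq> 0\<close> by (auto simp: D_def)
  \<comment> \<open>The coordinate with the largest relative difference, that is, the one of least order, supplies
    the common factor \<open>h j0\<close> of all the differences.\<close>
  define j0 where "j0 = arg_min_on (val_order \<circ> h) D"
  have j0: "h j0 \<noteq> 0" using arg_min_if_finite(1)[OF D] by (simp add: j0_def D_def)
  have least: "val_order (h j0) \<le> val_order (h i)" if "h i \<noteq> 0" for i
    using arg_min_least[OF D, of i "val_order \<circ> h"] that by (simp add: j0_def D_def)
  define g where "g i = h i / h j0" for i
  have g: "g i \<in> val_ring v" for i
  proof (cases "h i = 0")
    case False
    then show ?thesis
      using least[of i] j0 by (simp add: g_def val_ring_iff divide_inverse val_order_mult val_order_inverse)
  qed (simp add: g_def)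
  have lin: "linearizes (h j0) (y $ i / x $ i) (res (g i))" for i
    unfolding linearizes_def using g j0 by (intro bexI[of _ "g i"]) (auto simp: g_def h_def)
  have "linearizes (h j0) (\<Prod>i\<in>UNIV. (y $ i / x $ i) powi (\<alpha> $ i)) (\<Sum>i\<in>UNIV. of_int (\<alpha> $ i) * res (g i))" for \<alpha>
    by (intro linearizes_prod[OF h] linearizes_power_int[OF h lin])
  then obtain e where e: "e \<alpha> \<in> val_ring v"
      "(\<Prod>i\<in>UNIV. (y $ i / x $ i) powi (\<alpha> $ i)) = 1 + h j0 * e \<alpha>"
      "res (e \<alpha>) = (\<Sum>i\<in>UNIV. of_int (\<alpha> $ i) * res (g i))" for \<alpha>
    unfolding linearizes_def by metis
  have term_y: "term_at (F i) y \<alpha> = term_at (F i) x \<alpha> * (1 + h j0 * e \<alpha>)" for i \<alpha>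
  proof -
    have "eval_monomial \<alpha> y = eval_monomial \<alpha> x * (\<Prod>i\<in>UNIV. (y $ i / x $ i) powi (\<alpha> $ i))"
      unfolding prod.distrib[symmetric] power_int_mult_distrib[symmetric] using nzx by simp
    then show ?thesis by (simp only: e(2) mult.assoc)
  qed
  have "(\<Sum>\<alpha>\<in>Poly_Mapping.keys (F i). term_at (F i) x \<alpha> * e \<alpha>) = 0" for i
  proof -
    have "0 = eval_laurent (F i) y - eval_laurent (F i) x"
      using x y by (simp add: torus_zeros_def)
    also have "\<dots> = (\<Sum>\<alpha>\<in>Poly_Mapping.keys (F i). h j0 * (term_at (F i) x \<alpha> * e \<alpha>))"
      unfolding eval_laurent_def term_y sum_subtractf[symmetric] by (intro sum.cong) (auto simp: algebra_simps)
    finally show ?thesis using j0 by (simp add: sum_distrib_left[symmetric])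
  qed
  then have ker: "(\<Sum>\<alpha>\<in>min_keys v (F i) (val_vec x).
      digit (term_at (F i) x \<alpha>) * (\<Sum>j\<in>UNIV. of_int (\<alpha> $ j) * res (g j))) = 0" for i
    using weighted_residue_sum[of x e, OF nzx e(1)] by (simp add: e(3))
  have "jacobian_det (\<lambda>i. initial_form v \<pi> res (F i) (val_vec x)) (digit_vec x) = 0"
  proof (rule jacobian_det_eq_0[where \<eta> = "\<lambda>j. res (g j)" and ?j0.0 = j0])
    show "digit_vec x $ i \<noteq> 0" for i by (simp add: digit_vec_def digit_nonzero nzx)
    show "res (g j0) \<noteq> 0" using j0 by (simp add: g_def res_one)
    show "(\<Sum>\<alpha>\<in>Poly_Mapping.keys (initial_form v \<pi> res (F i) (val_vec x)).
        Poly_Mapping.lookup (initial_form v \<pi> res (F i) (val_vec x)) \<alpha> * eval_monomial \<alpha> (digit_vec x)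
          * (\<Sum>j\<in>UNIV. of_int (\<alpha> $ j) * res (g j))) = 0" for i
      using ker[of i] initial_form_term[of x, OF nzx] by (simp add: keys_initial_form cong: sum.cong)
  qed
  then show ?thesis using digit_vec_torus_zero[OF x] by (simp add: degenerate_zero_def)
qed

end

section \<open>Counting the zeros\<close>

theorem theorem1p1:
  fixes v :: "'a::field \<Rightarrow> ereal" and \<pi> :: 'a and res :: "'a \<Rightarrow> 'k::field"
    and F :: "'n::finite \<Rightarrow> ('a, 'n) laurent"
  assumes "discrete_valuation v" and "val_complete v"
    and "uniformizer v \<pi>" and "residue_map v res" and "finite (UNIV :: 'k set)"
    and "\<forall>i. F i \<noteq> 0" and "regular v \<pi> res F"
  shows "finite (torus_zeros F) \<and>
    card (torus_zeros F) \<le>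
      (\<Prod>i\<in>UNIV. card (Poly_Mapping.keys (F i)) choose 2) * card (- {0 :: 'k}) ^ CARD('n)"
proof -
  interpret valued_field_with_residue v res \<pi>
    using assms(1,3,4)
    by (simp add: valued_field_with_residue_def valued_field_with_residue_axioms_def)
  let ?T = "Trop_sys v F" and ?D = "\<Pi>\<^sub>E i\<in>(UNIV :: 'n set). - {0 :: 'k}"
  let ?\<phi> = "\<lambda>x. (val_vec x, vec_nth (digit_vec x))"
  have two: "card (min_keys v (F i) w) = 2" and semi: "semiregular v \<pi> res F w"
    if "w \<in> ?T" for w i
    using assms(7) that by (auto simp: regular_def keys_lower_poly)
  have finT: "finite ?T" using assms(7) by (simp add: regular_def)
  have finD: "finite ?D"
    using finite_subset[OF subset_UNIV assms(5)] by (intro finite_PiE) auto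
  have trop: "val_vec x \<in> ?T" if "x \<in> torus_zeros F" for x
    using that assms(6) zero_val_vec_in_Trop[of x] by (auto simp: torus_zeros_def Trop_sys_def)
  have inj: "inj_on ?\<phi> (torus_zeros F)"
  proof (rule inj_onI)
    fix x y assume x: "x \<in> torus_zeros F" and y: "y \<in> torus_zeros F" and eq: "?\<phi> x = ?\<phi> y"
    \<comment> \<open>Values of points of the torus lie in the lattice \<open>v(\<pi>) \<int>\<^sup>n\<close>, the only place where semiregularity
      forbids degenerate zeros.\<close>
    have "val_vec x \<in> range (\<lambda>m. real_of_ereal (v \<pi>) *\<^sub>R real_vec m)"
      using x val_vec_eq[of x] by (auto simp: torus_zeros_def val_gen_def)
    then have "\<not> degenerate_zero (\<lambda>i. initial_form v \<pi> res (F i) (val_vec x)) (digit_vec x)"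
      using semi[OF trop[OF x]] trop[OF x] unfolding semiregular_def by blast
    then show "x = y"
      using distinct_zeros_imp_degenerate[OF x y] eq by (auto simp: vec_nth_inject)
  qed
  have sub: "?\<phi> ` torus_zeros F \<subseteq> ?T \<times> ?D"
    using trop by (auto simp: torus_zeros_def digit_vec_def digit_nonzero)
  have fin: "finite (torus_zeros F)"
    by (rule finite_imageD[OF finite_subset[OF sub] inj]) (intro finite_cartesian_product finT finD)
  have "card (torus_zeros F) \<le> card (?T \<times> ?D)"
    using inj sub finT finD by (intro card_inj_on_le) auto
  also have "\<dots> = card ?T * card (- {0 :: 'k}) ^ CARD('n)"
    by (simp add: card_cartesian_product card_PiE)
  also have "\<dots> \<le> (\<Prod>i\<in>UNIV. card (Poly_Mapping.keys (F i)) choose 2) * card (- {0 :: 'k}) ^ CARD('n)"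
    using card_Trop_sys_le[OF finT two] by (rule mult_le_mono1)
  finally show ?thesis using fin by simp
qed

end
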